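(* Let $B$ be a symmetric positive definite operator on a $k$-dimensional real inner product space ($k\ge1$) with eigenvalues $\nu_1\ge\cdots\ge\nu_k>0$, condition number $\kappa_B=\nu_1/\nu_k$, and $\bar\omega=\frac1k\sum_{i=1}^k\nu_i^{-1}$. Let $\widetilde\Gamma=\bar\omega\,\Pi$ be the isotropic operator on $\mathrm{range}(B)$, where $\Pi$ is the orthogonal projector onto $\mathrm{range}(B)$ (the identity of the $k$-dimensional space). Then: (i) $\widetilde\Gamma=B^{-1}$ if and only if $\kappa_B=1$. (ii) $\|B^{-1}-\widetilde\Gamma\|_2\le\bar\omega\,(\kappa_B-1)$. (iii) $\dfrac1k\,\mathrm{KL}\bigl(\mathcal{N}(0,\widetilde\Gamma)\,\big\|\,\mathcal{N}(0,B^{-1})\bigr)\le\tfrac12(\kappa_B-1)^2$.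
   Context: $\|\cdot\|_2$ is the operator (spectral) norm. $\mathrm{KL}(P\|Q)$ is the Kullback–Leibler divergence of $P$ from $Q$; for centred Gaussians on a $k$-dimensional space with positive definite covariances, $\mathrm{KL}(\mathcal{N}(0,\Sigma_0)\|\mathcal{N}(0,\Sigma_1))=\frac12\bigl(\mathrm{tr}(\Sigma_1^{-1}\Sigma_0)-k-\log\det(\Sigma_1^{-1}\Sigma_0)\bigr)$. *)

theory Defs
  imports "HOL-Probability.Probability" "HOL-Combinatorics.Permutations" "HOL-Library.Multiset"
begin

definition sym_pos_def :: "('a::euclidean_space \<Rightarrow> 'a) \<Rightarrow> bool" where
  "sym_pos_def A \<longleftrightarrow> linear A \<and> (\<forall>x y. A x \<bullet> y = x \<bullet> A y) \<and> (\<forall>x. x \<noteq> 0 \<longrightarrow> 0 < A x \<bullet> x)"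

definition eigenspace :: "('a::euclidean_space \<Rightarrow> 'a) \<Rightarrow> real \<Rightarrow> 'a set" where
  "eigenspace A c = {x. A x = c *\<^sub>R x}"

(* Real eigenvalues in decreasing order, repeated according to the dimension of the eigenspace
   (for a symmetric operator geometric and algebraic multiplicities agree). *)
definition eigenvalue_list :: "('a::euclidean_space \<Rightarrow> 'a) \<Rightarrow> real list" where
  "eigenvalue_list A = rev (sorted_list_of_multiset
     (\<Sum>c | eigenspace A c \<noteq> {0}. replicate_mset (dim (eigenspace A c)) c))"

(* Indexed from 1, so that eigenval A 1 is the largest one. *)
definition eigenval :: "('a::euclidean_space \<Rightarrow> 'a) \<Rightarrow> nat \<Rightarrow> real" where
  "eigenval A i = eigenvalue_list A ! (i - 1)"

definition orth_projector :: "'a::euclidean_space set \<Rightarrow> 'a \<Rightarrow> 'a" where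
  "orth_projector S x = (THE p. p \<in> S \<and> x - p \<in> S\<^sup>\<bottom>)"

(* Leibniz determinant of the matrix of A in the orthonormal basis Basis. *)
definition op_det :: "('a::euclidean_space \<Rightarrow> 'a) \<Rightarrow> real" where
  "op_det A = (\<Sum>p | p permutes (Basis :: 'a set). of_int (sign p) * (\<Prod>i\<in>Basis. A (p i) \<bullet> i))"

(* The centred Gaussian law with covariance operator C, for C symmetric positive definite. *)
definition centred_gaussian :: "('a::euclidean_space \<Rightarrow> 'a) \<Rightarrow> 'a measure" where
  "centred_gaussian C = density lborel
     (\<lambda>x. ennreal (exp (- (x \<bullet> inv C x) / 2) / sqrt ((2 * pi) ^ DIM('a) * op_det C)))"

(* KL(P || Q), natural logarithm. KL_divergence takes the reference measure first:
   KL_divergence b Q P is the integral of log b (dP/dQ) with respect to P. *)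
definition KL :: "'a measure \<Rightarrow> 'a measure \<Rightarrow> real" where
  "KL P Q = KL_divergence (exp 1) Q P"

end

theory Submission
  imports Defs
begin

text \<open>
  Diagonalise \<open>B\<close> in an orthonormal eigenbasis \<open>E\<close> with eigenvalues \<open>l e\<close> and put \<open>t e = \<omega> * l e\<close>.
  Since \<open>\<omega>\<close> is the mean of the \<open>1 / l e\<close>, both \<open>t e\<close> and \<open>1 / t e\<close> are at most \<open>\<kappa>\<close>. The operator
  \<open>B\<inverse> - \<omega> I\<close> has eigenvalues \<open>\<omega> (1 / t e - 1)\<close>, which gives (ii), and (ii) at \<open>\<kappa> = 1\<close> gives the
  nontrivial half of (i). Twice the divergence is the sum of the \<open>t e - 1 - ln (t e)\<close>, and each
  summand is at most \<open>(t e - 1)\<^sup>2 / t e \<le> (\<kappa> - 1)\<^sup>2\<close> because \<open>ln t \<ge> 1 - 1 / t\<close>.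
\<close>

definition orthonormal_basis :: "'a::euclidean_space set \<Rightarrow> bool" where
  "orthonormal_basis E \<longleftrightarrow> finite E \<and> pairwise orthogonal E \<and> (\<forall>e\<in>E. norm e = 1) \<and> span E = UNIV"

subsection \<open>Spectral theorem\<close>

text \<open>A maximiser \<open>v\<close> of the Rayleigh quotient on the unit sphere of \<open>S\<close>, with maximum \<open>c\<close>, is an
  eigenvector: otherwise moving from \<open>v\<close> in the direction \<open>u = T v - c v\<close> would increase the quotient.\<close>

lemma symmetric_eigenvector:
  fixes T :: "'a::euclidean_space \<Rightarrow> 'a"
  assumes T: "linear T" and sym: "\<And>x y. T x \<bullet> y = x \<bullet> T y"
    and S: "subspace S" and inv: "\<And>x. x \<in> S \<Longrightarrow> T x \<in> S" and ne: "\<exists>x\<in>S. x \<noteq> 0"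
  obtains v c where "v \<in> S" "norm v = 1" "T v = c *\<^sub>R v"
proof -
  let ?K = "S \<inter> sphere 0 1"
  have "compact ?K"
    using S by (intro closed_Int_compact closed_subspace) auto
  moreover have "?K \<noteq> {}"
  proof -
    obtain x where "x \<in> S" "x \<noteq> 0" using ne by blast
    hence "(1 / norm x) *\<^sub>R x \<in> ?K"
      using S by (auto simp: subspace_scale)
    thus ?thesis by blast
  qed
  moreover have "continuous_on ?K (\<lambda>x. T x \<bullet> x)"
    using T by (intro continuous_on_inner linear_continuous_on continuous_on_id)
      (simp add: linear_conv_bounded_linear)
  ultimately have "\<exists>v\<in>?K. \<forall>x\<in>?K. T x \<bullet> x \<le> T v \<bullet> v"
    by (rule continuous_attains_sup)
  then obtain v where v: "v \<in> ?K" and max: "\<And>x. x \<in> ?K \<Longrightarrow> T x \<bullet> x \<le> T v \<bullet> v"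
    by blast
  define c where "c = T v \<bullet> v"
  have vS: "v \<in> S" and nv: "norm v = 1" using v by auto
  \<comment> \<open>By homogeneity the maximum over the unit sphere bounds the quadratic form on all
    of \<open>S\<close>.\<close>
  have le: "T x \<bullet> x \<le> c * (x \<bullet> x)" if "x \<in> S" for x
  proof (cases "x = 0")
    case True
    then show ?thesis by simp
  next
    case False
    hence "(1 / norm x) *\<^sub>R x \<in> ?K"
      using S that by (auto simp: subspace_scale)
    from max[OF this] have "(T x \<bullet> x) / (norm x)\<^sup>2 \<le> c"
      by (simp add: linear_cmul[OF T] c_def power2_eq_square)
    thus ?thesis using False by (simp add: field_simps power2_norm_eq_inner)
  qed
  define u where "u = T v - c *\<^sub>R v"
  have uS: "u \<in> S" unfolding u_def using S vS inv by (simp add: subspace_diff subspace_scale)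
  define a where "a = u \<bullet> u"
  define d where "d = c * (u \<bullet> u) - T u \<bullet> u"
  \<comment> \<open>This is \<open>le\<close> at \<open>v + t u\<close>: the terms of order zero
    cancel because \<open>v\<close> attains the maximum, and the first-order coefficient is
    \<open>2 * a\<close> since
    \<open>T v \<bullet> u - c * (v \<bullet> u) = u \<bullet> u\<close>.\<close>
  have quad: "2 * t * a \<le> t\<^sup>2 * d" for t
  proof -
    have "v + t *\<^sub>R u \<in> S" using S vS uS by (simp add: subspace_add subspace_scale)
    from le[OF this]
    have "T v \<bullet> v + 2 * t * (T v \<bullet> u) + t\<^sup>2 * (T u \<bullet> u)
        \<le> c * (v \<bullet> v + 2 * t * (v \<bullet> u) + t\<^sup>2 * (u \<bullet> u))"
      using sym[of u v]
      by (simp add: linear_add[OF T] linear_cmul[OF T]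
          inner_commute[of u v] inner_commute[of u "T v"] power2_eq_square algebra_simps)
    moreover have "v \<bullet> v = 1" using nv by (simp add: dot_square_norm)
    moreover have "T v \<bullet> u - c * (v \<bullet> u) = a"
      by (simp add: a_def u_def inner_diff_left)
    ultimately show ?thesis
      unfolding d_def c_def by (simp add: algebra_simps)
  qed
  have "a \<le> 0"
  proof (rule ccontr)
    assume "\<not> a \<le> 0"
    hence a: "a > 0" by simp
    \<comment> \<open>Dividing \<open>quad\<close> by \<open>t > 0\<close> leaves
      \<open>2 * a \<le> t * d\<close>. This \<open>t\<close> is small enough to force
      \<open>t * d \<le> a\<close>; the summand 1 keeps the denominator positive when
      \<open>d = 0\<close>.\<close>
    define t where "t = a / (\<bar>d\<bar> + 1)"
    have t: "t > 0" using a by (simp add: t_def)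
    have "2 * a \<le> t * d" using quad[of t] t by (simp add: power2_eq_square)
    also have "\<dots> \<le> t * (\<bar>d\<bar> + 1)" using t by (intro mult_left_mono) auto
    also have "\<dots> = a" by (simp add: t_def)
    finally show False using a by simp
  qed
  hence "u = 0" using inner_gt_zero_iff[of u] by (fastforce simp: a_def)
  hence "T v = c *\<^sub>R v" by (simp add: u_def)
  with vS nv show thesis by (rule that)
qed

text \<open>Induction on the dimension: split off a unit eigenvector \<open>v\<close> and continue
  in its orthogonal complement within \<open>S\<close>. Symmetry makes the complement invariant, as
  \<open>v \<bullet> T x = T v \<bullet> x = c * (v \<bullet> x) = 0\<close>. Quantifying over
  invariant subspaces keeps the induction inside one type.\<close>

lemma spectral_theorem_subspace:
  fixes T :: "'a::euclidean_space \<Rightarrow> 'a"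
  assumes T: "linear T" and sym: "\<And>x y. T x \<bullet> y = x \<bullet> T y"
    and "subspace S" and "\<And>x. x \<in> S \<Longrightarrow> T x \<in> S"
  shows "\<exists>E. finite E \<and> pairwise orthogonal E \<and> (\<forall>e\<in>E. norm e = 1) \<and> span E = S \<and>
    (\<forall>e\<in>E. \<exists>c. T e = c *\<^sub>R e)"
  using assms(3,4)
proof (induction "dim S" arbitrary: S rule: less_induct)
  case less
  note S = \<open>subspace S\<close>
  show ?case
  proof (cases "\<exists>x\<in>S. x \<noteq> 0")
    case False
    hence "S = {0}" using subspace_0[OF S] by auto
    thus ?thesis by (intro exI[of _ "{}"]) auto
  next
    case True
    obtain v c where v: "v \<in> S" "norm v = 1" "T v = c *\<^sub>R v"
      using symmetric_eigenvector[OF T sym S less.prems(2) True] by metis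
    have vv: "v \<bullet> v = 1" using v by (simp add: dot_square_norm)
    let ?S = "S \<inter> {x. v \<bullet> x = 0}"
    have sub: "subspace ?S"
      using S by (intro subspace_inter subspace_hyperplane)
    have "v \<notin> ?S" using vv by simp
    hence "?S \<subset> S" using v by blast
    hence "dim ?S < dim S"
      using S sub by (metis dim_psubset span_eq_iff)
    moreover have "T x \<in> ?S" if "x \<in> ?S" for x
      using that less.prems(2) sym[of v x] v(3) by auto
    ultimately obtain E where E: "finite E" "pairwise orthogonal E" "\<forall>e\<in>E. norm e = 1" "span E = ?S"
      "\<forall>e\<in>E. \<exists>c. T e = c *\<^sub>R e"
      using less.hyps[OF _ sub] by meson
    have ES: "E \<subseteq> ?S" using E(4) span_superset by blast
    have "span (insert v E) = S"
    proof
      show "span (insert v E) \<subseteq> S"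
        using ES v S by (intro span_minimal) auto
      show "S \<subseteq> span (insert v E)"
      proof
        fix x assume x: "x \<in> S"
        have "x - (v \<bullet> x) *\<^sub>R v \<in> ?S"
          using x v S vv by (auto simp: subspace_diff subspace_scale inner_diff_right)
        thus "x \<in> span (insert v E)"
          unfolding span_insert using E(4) by auto
      qed
    qed
    moreover have "pairwise orthogonal (insert v E)"
      using E(2) ES by (auto simp: pairwise_insert orthogonal_def inner_commute)
    ultimately show ?thesis
      using E v by (intro exI[of _ "insert v E"]) auto
  qed
qed

lemma spectral_theorem:
  fixes T :: "'a::euclidean_space \<Rightarrow> 'a"
  assumes T: "linear T" and sym: "\<And>x y. T x \<bullet> y = x \<bullet> T y"
  obtains E l where "orthonormal_basis E" "\<And>e. e \<in> E \<Longrightarrow> T e = l e *\<^sub>R e"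
proof -
  obtain E where E: "finite E" "pairwise orthogonal E" "\<forall>e\<in>E. norm e = 1" "span E = UNIV"
    "\<forall>e\<in>E. \<exists>c. T e = c *\<^sub>R e"
    using spectral_theorem_subspace[OF T sym, of UNIV] by auto
  from E(5) obtain l where "\<forall>e\<in>E. T e = l e *\<^sub>R e" by metis
  thus thesis using E that[of E l] by (auto simp: orthonormal_basis_def)
qed

section \<open>Coordinates with respect to an orthonormal basis\<close>

context
  fixes E :: "'a::euclidean_space set"
  assumes E: "orthonormal_basis E"
begin

lemma finite_orthonormal_basis: "finite E"
  using E by (simp add: orthonormal_basis_def)

lemma inner_orthonormal_basis:
  assumes "e \<in> E" "f \<in> E"
  shows "e \<bullet> f = (if e = f then 1 else 0)"
proof (cases "e = f")
  case True
  then show ?thesis using E assms by (simp add: orthonormal_basis_def dot_square_norm)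
next
  case False
  then show ?thesis using E assms by (simp add: orthonormal_basis_def pairwise_def orthogonal_def)
qed

lemma independent_orthonormal_basis: "independent E"
proof (rule pairwise_orthogonal_independent)
  show "pairwise orthogonal E" using E by (simp add: orthonormal_basis_def)
  show "0 \<notin> E" using E by (force simp: orthonormal_basis_def)
qed

lemma card_orthonormal_basis: "card E = DIM('a)"
  using dim_eq_card[OF _ independent_orthonormal_basis, of UNIV] E
  by (simp add: orthonormal_basis_def)

lemma orthonormal_basis_nonempty: "E \<noteq> {}"
  using card_orthonormal_basis DIM_positive[where 'a='a] by force

lemma inner_sum_orthonormal_basis:
  assumes "e \<in> E"
  shows "(\<Sum>f\<in>E. c f *\<^sub>R f) \<bullet> e = c e"
proof -
  have "(\<Sum>f\<in>E. c f *\<^sub>R f) \<bullet> e = (\<Sum>f\<in>E. if f = e then c f else 0)"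
    unfolding inner_sum_left
    using assms by (intro sum.cong) (auto simp: inner_orthonormal_basis)
  thus ?thesis using assms finite_orthonormal_basis by simp
qed

lemma orthonormal_basis_expansion: "x = (\<Sum>e\<in>E. (x \<bullet> e) *\<^sub>R e)"
proof -
  \<comment> \<open>The residual is orthogonal to all of \<open>E\<close>, hence to
    \<open>span E\<close>, to which it belongs itself.\<close>
  define y where "y = x - (\<Sum>e\<in>E. (x \<bullet> e) *\<^sub>R e)"
  have "orthogonal y e" if "e \<in> E" for e
    using that by (simp add: y_def orthogonal_def inner_diff_left inner_sum_orthonormal_basis)
  moreover have "y \<in> span E" using E by (simp add: orthonormal_basis_def)
  ultimately have "y = 0"
    using orthogonal_to_span orthogonal_self by blast
  thus ?thesis by (simp add: y_def)
qed

lemma inner_orthonormal_basis_expansion: "x \<bullet> y = (\<Sum>e\<in>E. (x \<bullet> e) * (y \<bullet> e))"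
proof -
  have "x \<bullet> y = (\<Sum>e\<in>E. (x \<bullet> e) *\<^sub>R e) \<bullet> y"
    using orthonormal_basis_expansion[of x] by simp
  also have "\<dots> = (\<Sum>e\<in>E. (x \<bullet> e) * (e \<bullet> y))" by (simp add: inner_sum_left)
  also have "\<dots> = (\<Sum>e\<in>E. (x \<bullet> e) * (y \<bullet> e))" by (simp add: inner_commute)
  finally show ?thesis .
qed

lemma norm_orthonormal_basis_expansion: "(norm x)\<^sup>2 = (\<Sum>e\<in>E. (x \<bullet> e)\<^sup>2)"
  unfolding power2_norm_eq_inner by (simp only: inner_orthonormal_basis_expansion[of x x] power2_eq_square)

text \<open>Expand each \<open>e\<close> in \<open>Basis\<close> and swap the sums; the sum over
  \<open>E\<close> then collapses by Parseval. This turns the trace taken in \<open>Basis\<close>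
  into a sum of eigenvalues.\<close>

lemma trace_orthonormal_basis:
  assumes A: "linear A"
  shows "(\<Sum>b\<in>Basis. A b \<bullet> b) = (\<Sum>e\<in>E. A e \<bullet> e)"
proof -
  have "(\<Sum>e\<in>E. A e \<bullet> e) = (\<Sum>e\<in>E. \<Sum>b\<in>Basis. (e \<bullet> b) * (A b \<bullet> e))"
  proof (rule sum.cong[OF refl])
    fix e
    have "A e = A (\<Sum>b\<in>Basis. (e \<bullet> b) *\<^sub>R b)" by (simp add: euclidean_representation)
    thus "A e \<bullet> e = (\<Sum>b\<in>Basis. (e \<bullet> b) * (A b \<bullet> e))"
      by (simp add: linear_sum[OF A] linear_cmul[OF A] inner_sum_left)
  qed
  also have "\<dots> = (\<Sum>b\<in>Basis. \<Sum>e\<in>E. (b \<bullet> e) * (A b \<bullet> e))"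
    by (subst sum.swap) (simp add: inner_commute)
  also have "\<dots> = (\<Sum>b\<in>Basis. b \<bullet> A b)"
    by (simp flip: inner_orthonormal_basis_expansion)
  also have "\<dots> = (\<Sum>b\<in>Basis. A b \<bullet> b)"
    by (simp add: inner_commute)
  finally show ?thesis ..
qed

section \<open>Eigenvalue list of an operator with an orthonormal eigenbasis\<close>

context
  fixes A :: "'a \<Rightarrow> 'a" and l :: "'a \<Rightarrow> real"
  assumes A: "linear A" and eig: "\<And>e. e \<in> E \<Longrightarrow> A e = l e *\<^sub>R e"
begin

lemma inner_eigenbasis: assumes "e \<in> E" shows "A x \<bullet> e = l e * (x \<bullet> e)"
proof -
  have "A x = A (\<Sum>f\<in>E. (x \<bullet> f) *\<^sub>R f)"
    using orthonormal_basis_expansion[of x] by simp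
  also have "\<dots> = (\<Sum>f\<in>E. (l f * (x \<bullet> f)) *\<^sub>R f)"
    by (simp add: linear_sum[OF A] linear_cmul[OF A] eig mult.commute)
  finally show ?thesis
    using inner_sum_orthonormal_basis[OF assms] by simp
qed

text \<open>If \<open>A x = c *\<^sub>R x\<close>, comparing coordinates gives
  \<open>l e * (x \<bullet> e) = c * (x \<bullet> e)\<close>, so only coordinates with
  \<open>l e = c\<close> can be nonzero.\<close>

lemma eigenspace_eigenbasis: "eigenspace A c = span {e\<in>E. l e = c}"
proof
  show "span {e\<in>E. l e = c} \<subseteq> eigenspace A c"
  proof (rule span_minimal)
    show "subspace (eigenspace A c)"
      by (auto simp: subspace_def eigenspace_def linear_add[OF A] linear_cmul[OF A] linear_0[OF A] algebra_simps)
  qed (auto simp: eigenspace_def eig)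
  show "eigenspace A c \<subseteq> span {e\<in>E. l e = c}"
  proof
    fix x assume x: "x \<in> eigenspace A c"
    have "x \<bullet> e = 0" if "e \<in> E" "l e \<noteq> c" for e
      using inner_eigenbasis[OF that(1), of x] x that by (simp add: eigenspace_def)
    hence "(\<Sum>e\<in>E. (x \<bullet> e) *\<^sub>R e) = (\<Sum>e\<in>{e\<in>E. l e = c}. (x \<bullet> e) *\<^sub>R e)"
      using finite_orthonormal_basis by (intro sum.mono_neutral_right) auto
    hence "x = (\<Sum>e\<in>{e\<in>E. l e = c}. (x \<bullet> e) *\<^sub>R e)"
      using orthonormal_basis_expansion[of x] by simp
    thus "x \<in> span {e\<in>E. l e = c}"
      by (metis (no_types, lifting) span_base span_scale span_sum)
  qed
qed

lemma dim_eigenspace: "dim (eigenspace A c) = card {e\<in>E. l e = c}"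
  unfolding eigenspace_eigenbasis dim_span
  using independent_orthonormal_basis by (intro dim_eq_card_independent) (rule independent_mono, auto)

text \<open>Bridge from the basis-free list to the chosen eigenbasis: the multiplicity of
  \<open>c\<close> is the dimension of its eigenspace, which is the number of \<open>e\<close> with
  \<open>l e = c\<close>.\<close>

lemma mset_eigenvalue_list: "mset (eigenvalue_list A) = image_mset l (mset_set E)"
proof -
  have 1: "{c. eigenspace A c \<noteq> {0}} = l ` E"
  proof -
    have "eigenspace A c \<noteq> {0} \<longleftrightarrow> dim (eigenspace A c) \<noteq> 0" for c
    proof -
      have "0 \<in> eigenspace A c" by (simp add: eigenspace_def linear_0[OF A])
      thus ?thesis by auto
    qed
    thus ?thesis using finite_orthonormal_basis by (auto simp: dim_eigenspace)
  qed
  have "count (\<Sum>c\<in>l ` E. replicate_mset (card {e\<in>E. l e = c}) c) d = count (image_mset l (mset_set E)) d" for d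
  proof -
    have "count (\<Sum>c\<in>l ` E. replicate_mset (card {e\<in>E. l e = c}) c) d = card {e\<in>E. l e = d}"
      using finite_orthonormal_basis by (auto simp: count_sum)
    also have "\<dots> = count (image_mset l (mset_set E)) d"
      using finite_orthonormal_basis
      by (simp add: count_image_mset vimage_def Int_def conj_commute)
    finally show ?thesis .
  qed
  thus ?thesis
    unfolding eigenvalue_list_def 1 dim_eigenspace by (auto intro: multiset_eqI)
qed

lemma length_eigenvalue_list: "length (eigenvalue_list A) = DIM('a)"
  using arg_cong[OF mset_eigenvalue_list, of size] by (simp add: card_orthonormal_basis)

lemma sum_eigenval: "(\<Sum>i=1..DIM('a). f (eigenval A i)) = (\<Sum>e\<in>E. f (l e))"
proof -
  \<comment> \<open>\<open>eigenval\<close> counts from 1 and list positions from 0, hence the shift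
    by \<open>Suc\<close>.\<close>
  have "(\<Sum>i=1..DIM('a). f (eigenval A i)) = (\<Sum>i<DIM('a). f (eigenvalue_list A ! i))"
    unfolding eigenval_def
    by (rule sum.reindex_bij_witness[of _ Suc "\<lambda>i. i - 1"]) auto
  also have "\<dots> = sum_mset (image_mset f (mset (eigenvalue_list A)))"
    unfolding mset_map[symmetric] sum_mset_sum_list
    by (simp add: sum_list_sum_nth length_eigenvalue_list atLeast0LessThan)
  also have "\<dots> = (\<Sum>e\<in>E. f (l e))"
    by (simp add: mset_eigenvalue_list image_mset.compositionality o_def sum_unfold_sum_mset)
  finally show ?thesis .
qed

lemma eigenval_image: "eigenval A ` {1..DIM('a)} = l ` E"
proof -
  have "l ` E = set (eigenvalue_list A)"
    using arg_cong[OF mset_eigenvalue_list, of set_mset] finite_orthonormal_basis by simp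
  also have "\<dots> = (\<lambda>i. eigenvalue_list A ! i) ` {..<DIM('a)}"
    by (auto simp: set_conv_nth length_eigenvalue_list)
  also have "{..<DIM('a)} = (\<lambda>i. i - 1) ` {1..DIM('a)}"
    by (auto simp: image_iff intro!: bexI[of _ "Suc _"])
  finally show ?thesis by (simp add: image_image eigenval_def)
qed

lemma eigenval_antimono:
  assumes "1 \<le> i" "i \<le> j" "j \<le> DIM('a)"
  shows "eigenval A j \<le> eigenval A i"
proof -
  have "sorted (rev (eigenvalue_list A))"
    by (simp add: eigenvalue_list_def)
  thus ?thesis
    using assms unfolding eigenval_def
    by (intro sorted_rev_nth_mono) (auto simp: length_eigenvalue_list)
qed

lemma eigenval_bounds:
  assumes "e \<in> E"
  shows "l e \<le> eigenval A 1" "eigenval A DIM('a) \<le> l e"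
proof -
  obtain i where "i \<in> {1..DIM('a)}" "l e = eigenval A i"
    using eigenval_image assms by (metis imageE imageI)
  thus "l e \<le> eigenval A 1" "eigenval A DIM('a) \<le> l e"
    using eigenval_antimono by auto
qed

end

end

subsection \<open>Determinants\<close>

text \<open>Replace \<open>p\<close> by \<open>p \<circ> f\<close> in the Leibniz sum and reorder
  each product along \<open>f\<close>; the only change is the factor \<open>sign f\<close>.\<close>

lemma op_det_permuted_rows:
  fixes C :: "'a::euclidean_space \<Rightarrow> 'a"
  assumes f: "f permutes Basis"
  shows "(\<Sum>p | p permutes (Basis :: 'a set). of_int (sign p) * (\<Prod>i\<in>Basis. C (p i) \<bullet> f i)) =
    of_int (sign f) * op_det C"
proof -
  have pf: "permutation f" using f by (auto simp: permutation_permutes intro!: exI[of _ "Basis :: 'a set"])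
  have "of_int (sign f) * op_det C =
      (\<Sum>p | p permutes (Basis :: 'a set). of_int (sign f * sign p) * (\<Prod>i\<in>Basis. C (p i) \<bullet> i))"
    by (simp add: op_det_def sum_distrib_left mult_ac)
  also have "\<dots> = (\<Sum>p | p permutes (Basis :: 'a set). of_int (sign p) * (\<Prod>i\<in>Basis. C (p i) \<bullet> f i))"
  proof (rule sum.reindex_bij_witness[of _ "\<lambda>p. p \<circ> inv f" "\<lambda>p. p \<circ> f"])
    fix p assume "p \<in> {p. p permutes (Basis :: 'a set)}"
    hence p: "p permutes Basis" by simp
    hence pp: "permutation p" by (auto simp: permutation_permutes intro!: exI[of _ "Basis :: 'a set"])
    show "p \<circ> f \<circ> inv f = p" "p \<circ> inv f \<circ> f = p"
      using f by (auto simp: fun_eq_iff permutes_inverses)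
    show "p \<circ> f \<in> {p. p permutes Basis}" "p \<circ> inv f \<in> {p. p permutes Basis}"
      using f p by (auto intro: permutes_compose permutes_inv)
    have "(\<Prod>i\<in>Basis. C (p i) \<bullet> i) = (\<Prod>i\<in>Basis. C (p (f i)) \<bullet> f i)"
      by (rule prod.permute[OF f, unfolded o_def])
    thus "real_of_int (sign (p \<circ> f)) * (\<Prod>i\<in>Basis. C ((p \<circ> f) i) \<bullet> f i) =
      real_of_int (sign f * sign p) * (\<Prod>i\<in>Basis. C (p i) \<bullet> i)"
      by (simp add: sign_compose[OF pp pf])
  qed
  finally show ?thesis ..
qed

text \<open>Composing \<open>p\<close> with the transposition of \<open>a\<close> and
  \<open>b\<close> preserves each product, because \<open>f a = f b\<close>, but flips the sign. The
  sum therefore equals its own negative.\<close>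

lemma op_det_repeated_row:
  fixes C :: "'a::euclidean_space \<Rightarrow> 'a"
  assumes ab: "a \<in> Basis" "b \<in> Basis" "a \<noteq> b" "f a = f b"
  shows "(\<Sum>p | p permutes (Basis :: 'a set). of_int (sign p) * (\<Prod>i\<in>Basis. C (p i) \<bullet> f i)) = 0"
    (is "?S = 0")
proof -
  let ?t = "Transposition.transpose a b"
  have t: "?t permutes (Basis :: 'a set)" using ab by (simp add: permutes_swap_id)
  have "?S = (\<Sum>p | p permutes (Basis :: 'a set). - (of_int (sign p) * (\<Prod>i\<in>Basis. C (p i) \<bullet> f i)))"
  proof (rule sum.reindex_bij_witness[of _ "\<lambda>p. p \<circ> ?t" "\<lambda>p. p \<circ> ?t"])
    fix p assume "p \<in> {p. p permutes (Basis :: 'a set)}"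
    hence p: "p permutes Basis" by simp
    hence pp: "permutation p" by (auto simp: permutation_permutes intro!: exI[of _ "Basis :: 'a set"])
    show "p \<circ> ?t \<circ> ?t = p" "p \<circ> ?t \<circ> ?t = p"
      by (auto simp: fun_eq_iff)
    show "p \<circ> ?t \<in> {p. p permutes Basis}" "p \<circ> ?t \<in> {p. p permutes Basis}"
      using t p by (auto intro: permutes_compose)
    have "(\<Prod>i\<in>Basis. C (p i) \<bullet> f i) = (\<Prod>i\<in>Basis. C (p (?t i)) \<bullet> f (?t i))"
      by (rule prod.permute[OF t, unfolded o_def])
    moreover have "f (?t i) = f i" for i
      using ab(4) by (cases "i = a"; cases "i = b") auto
    ultimately show "- (real_of_int (sign (p \<circ> ?t)) * (\<Prod>i\<in>Basis. C ((p \<circ> ?t) i) \<bullet> f i)) =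
      real_of_int (sign p) * (\<Prod>i\<in>Basis. C (p i) \<bullet> f i)"
      using ab by (simp add: sign_compose[OF pp] permutation_swap_id sign_swap_id)
  qed
  thus ?thesis by (simp add: sum_negf)
qed

text \<open>Cauchy--Binet expansion: only those maps \<open>f\<close> on \<open>Basis\<close> survive that are permutations. The
  product formula ranges over extensional functions, hence the restrictions of permutations.\<close>

lemma op_det_compose:
  fixes A C :: "'a::euclidean_space \<Rightarrow> 'a"
  assumes A: "linear A"
  shows "op_det (A \<circ> C) = op_det A * op_det C"
proof -
  let ?P = "{p. p permutes (Basis :: 'a set)}"
  let ?F = "PiE (Basis :: 'a set) (\<lambda>_. Basis :: 'a set)"
  let ?T = "\<lambda>f. (\<Prod>i\<in>Basis. A (f i) \<bullet> i) *
    (\<Sum>p\<in>?P. of_int (sign p) * (\<Prod>i\<in>Basis. C (p i) \<bullet> f i))"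
  have entry: "A x \<bullet> i = (\<Sum>j\<in>Basis. (A j \<bullet> i) * (x \<bullet> j))" for x i
  proof -
    have "A x = A (\<Sum>j\<in>Basis. (x \<bullet> j) *\<^sub>R j)" by (simp add: euclidean_representation)
    thus ?thesis
      by (simp add: linear_sum[OF A] linear_cmul[OF A] inner_sum_left mult.commute)
  qed
  have "op_det (A \<circ> C) = (\<Sum>p\<in>?P. of_int (sign p) *
      (\<Prod>i\<in>Basis. \<Sum>j\<in>Basis. (A j \<bullet> i) * (C (p i) \<bullet> j)))"
    unfolding op_det_def by (simp flip: entry)
  also have "\<dots> = (\<Sum>p\<in>?P. \<Sum>f\<in>?F. of_int (sign p) *
      ((\<Prod>i\<in>Basis. A (f i) \<bullet> i) * (\<Prod>i\<in>Basis. C (p i) \<bullet> f i)))"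
    by (simp add: prod_sum_PiE prod.distrib sum_distrib_left)
  also have "\<dots> = (\<Sum>f\<in>?F. ?T f)"
    by (subst sum.swap) (simp add: sum_distrib_left mult_ac)
  also have "\<dots> = (\<Sum>f\<in>(\<lambda>p. restrict p Basis) ` ?P. ?T f)"
  proof (rule sum.mono_neutral_right)
    show "finite ?F" by (simp add: finite_PiE)
    show "(\<lambda>p. restrict p Basis) ` ?P \<subseteq> ?F"
      by (auto simp: permutes_in_image)
    show "\<forall>f\<in>?F - (\<lambda>p. restrict p Basis) ` ?P. ?T f = 0"
    proof
      fix f assume f: "f \<in> ?F - (\<lambda>p. restrict p Basis) ` ?P"
      have "\<not> inj_on f Basis"
      proof
        assume "inj_on f Basis"
        moreover have "f ` Basis \<subseteq> Basis" using f by auto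
        ultimately have bij: "bij_betw f Basis Basis"
          by (simp add: bij_betw_def endo_inj_surj)
        \<comment> \<open>An extensional \<open>f\<close> is \<open>undefined\<close> off
          \<open>Basis\<close>; extending it by the identity instead yields a permutation that
          restricts to \<open>f\<close>.\<close>
        let ?p = "\<lambda>i. if i \<in> Basis then f i else i"
        have "bij_betw ?p Basis Basis"
          using bij by (subst bij_betw_cong[of _ _ f]) auto
        hence "?p \<in> ?P" by (auto intro!: bij_imp_permutes)
        moreover have "restrict ?p Basis = f"
          using f by (auto simp: fun_eq_iff restrict_def PiE_def extensional_def)
        ultimately show False using f by (metis (no_types, lifting) DiffD2 image_eqI)
      qed
      then obtain a b where "a \<in> Basis" "b \<in> Basis" "a \<noteq> b" "f a = f b"
        by (auto simp: inj_on_def)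
      from op_det_repeated_row[where f=f, OF this, of C] show "?T f = 0" by simp
    qed
  qed
  also have "\<dots> = (\<Sum>f\<in>?P. ?T (restrict f Basis))"
  proof (rule sum.reindex[unfolded o_def])
    \<comment> \<open>Permutations of \<open>Basis\<close> fix everything outside it, so their
      restrictions determine them.\<close>
    show "inj_on (\<lambda>p. restrict p Basis) ?P"
    proof (rule inj_onI, rule ext)
      fix p q x assume "p \<in> ?P" "q \<in> ?P" "restrict p Basis = restrict q (Basis :: 'a set)"
      thus "p x = q x"
        by (cases "x \<in> Basis") (auto simp: restrict_def fun_eq_iff permutes_not_in, metis)
    qed
  qed
  also have "\<dots> = (\<Sum>f\<in>?P. (\<Prod>i\<in>Basis. A (f i) \<bullet> i) * (of_int (sign f) * op_det C))"
    by (rule sum.cong) (simp_all add: op_det_permuted_rows)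
  also have "\<dots> = op_det A * op_det C"
    unfolding op_det_def[of A] sum_distrib_right by (simp add: mult_ac)
  finally show ?thesis .
qed

text \<open>In every Leibniz term \<open>p\<close> meets each basis vector exactly once, so the
  factors \<open>d (p i)\<close> multiply to the same product for all \<open>p\<close>.\<close>

lemma op_det_scaled_columns:
  fixes P :: "'a::euclidean_space \<Rightarrow> 'a"
  assumes "\<And>b. b \<in> Basis \<Longrightarrow> Q b = d b *\<^sub>R P b"
  shows "op_det Q = (\<Prod>b\<in>Basis. d b) * op_det P"
proof -
  have "(\<Prod>i\<in>Basis. Q (p i) \<bullet> i) = (\<Prod>b\<in>Basis. d b) * (\<Prod>i\<in>Basis. P (p i) \<bullet> i)"
    if p: "p permutes Basis" for p
  proof -
    have "(\<Prod>i\<in>Basis. Q (p i) \<bullet> i) = (\<Prod>i\<in>Basis. d (p i) * (P (p i) \<bullet> i))"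
      using p assms by (intro prod.cong) (auto simp: permutes_in_image)
    also have "\<dots> = (\<Prod>b\<in>Basis. d b) * (\<Prod>i\<in>Basis. P (p i) \<bullet> i)"
      using prod.permute[OF p, of d] by (simp add: prod.distrib o_def)
    finally show ?thesis .
  qed
  thus ?thesis by (simp add: op_det_def sum_distrib_left mult_ac)
qed

text \<open>A permutation other than the identity moves some \<open>i\<close>, and then
  \<open>p i \<bullet> i = 0\<close> by orthogonality.\<close>

lemma op_det_id: "op_det (\<lambda>x::'a::euclidean_space. x) = 1"
proof -
  have "(\<Prod>i\<in>Basis. p i \<bullet> i) = 0" if p: "p permutes (Basis :: 'a set)" "p \<noteq> id" for p
  proof -
    obtain i where "p i \<noteq> i" using p by (auto simp: fun_eq_iff)
    moreover have "i \<in> Basis" using calculation p by (metis permutes_not_in)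
    ultimately show ?thesis
      using p by (intro prod_zero) (auto simp: inner_Basis permutes_in_image intro!: bexI[of _ i])
  qed
  hence "op_det (\<lambda>x::'a. x) = (\<Sum>p\<in>{id}. of_int (sign p) * (\<Prod>i\<in>(Basis::'a set). p i \<bullet> i))"
    unfolding op_det_def
    by (intro sum.mono_neutral_right) (auto simp: finite_permutations)
  thus ?thesis by simp
qed

subsection \<open>Gaussian integrals\<close>

text \<open>Lebesgue measure is the image of the product of its one-dimensional copies under the
  coordinate map, so Fubini splits the integral.\<close>

lemma lborel_integral_prod:
  fixes f :: "'a::euclidean_space \<Rightarrow> real \<Rightarrow> real"
  assumes int: "\<And>b. b \<in> Basis \<Longrightarrow> integrable lborel (f b)"
  shows "has_bochner_integral lborel (\<lambda>x::'a. \<Prod>b\<in>Basis. f b (x \<bullet> b))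
    (\<Prod>b\<in>Basis. integral\<^sup>L lborel (f b))"
proof -
  interpret product_sigma_finite "\<lambda>_. lborel :: real measure" ..
  let ?M = "Pi\<^sub>M (Basis :: 'a set) (\<lambda>_. lborel :: real measure)"
  let ?h = "\<lambda>y. \<Sum>b\<in>Basis. y b *\<^sub>R (b :: 'a)"
  have [measurable]: "f b \<in> borel_measurable borel" if "b \<in> Basis" for b
    using int[OF that] by (simp add: borel_measurable_integrable)
  have "has_bochner_integral ?M (\<lambda>y. \<Prod>b\<in>Basis. f b (y b)) (\<Prod>b\<in>Basis. integral\<^sup>L lborel (f b))"
    using int by (simp add: has_bochner_integral_iff product_integrable_prod product_integral_prod)
  moreover have "?h y \<bullet> b = y b" if "b \<in> Basis" for y b
    using that by (simp add: inner_sum_left inner_Basis if_distrib cong: if_cong)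
  ultimately have "has_bochner_integral ?M (\<lambda>y. \<Prod>b\<in>Basis. f b (?h y \<bullet> b))
      (\<Prod>b\<in>Basis. integral\<^sup>L lborel (f b))"
    by (simp cong: prod.cong)
  thus ?thesis
    by (subst lborel_eq, intro has_bochner_integral_distr) simp_all
qed

text \<open>Identifies the product of one-dimensional densities, which is convenient to integrate,
  with the density of the centred Gaussian of covariance \<open>\<sigma>\<^sup>2\<close> times the
  identity.\<close>

lemma normal_density_prod:
  fixes x :: "'a::euclidean_space"
  assumes "\<sigma> > 0"
  shows "(\<Prod>b\<in>Basis. normal_density 0 \<sigma> (x \<bullet> b)) =
    exp (- (x \<bullet> x) / (2 * \<sigma>\<^sup>2)) / sqrt ((2 * pi * \<sigma>\<^sup>2) ^ DIM('a))"
proof -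
  have "(\<Prod>b\<in>Basis. exp (- (x \<bullet> b)\<^sup>2 / (2 * \<sigma>\<^sup>2))) = exp (\<Sum>b\<in>Basis. - (x \<bullet> b)\<^sup>2 / (2 * \<sigma>\<^sup>2))"
    by (simp add: exp_sum)
  also have "(\<Sum>b\<in>Basis. - (x \<bullet> b)\<^sup>2 / (2 * \<sigma>\<^sup>2)) = - (x \<bullet> x) / (2 * \<sigma>\<^sup>2)"
    unfolding euclidean_inner[of x x] by (simp add: sum_divide_distrib sum_negf power2_eq_square)
  finally have e: "(\<Prod>b\<in>Basis. exp (- (x \<bullet> b)\<^sup>2 / (2 * \<sigma>\<^sup>2))) = exp (- (x \<bullet> x) / (2 * \<sigma>\<^sup>2))" .
  have "(\<Prod>b\<in>Basis. normal_density 0 \<sigma> (x \<bullet> b)) =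
      (1 / sqrt (2 * pi * \<sigma>\<^sup>2)) ^ DIM('a) * exp (- (x \<bullet> x) / (2 * \<sigma>\<^sup>2))"
    unfolding normal_density_def diff_0_right prod.distrib e by simp
  thus ?thesis
    by (simp only: real_sqrt_power power_one_over) simp
qed

lemma isotropic_second_moment:
  fixes i j :: "'a::euclidean_space"
  assumes \<sigma>: "\<sigma> > 0" and ij: "i \<in> Basis" "j \<in> Basis"
  shows "has_bochner_integral lborel
    (\<lambda>x::'a. (\<Prod>b\<in>Basis. normal_density 0 \<sigma> (x \<bullet> b)) * ((x \<bullet> i) * (x \<bullet> j)))
    (if i = j then \<sigma>\<^sup>2 else 0)"
proof -
  \<comment> \<open>\<open>n b\<close> counts the occurrences of \<open>b\<close> among
    \<open>i\<close> and \<open>j\<close>, so that \<open>(x \<bullet> i) * (x \<bullet> j)\<close>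
    becomes a product over all coordinates. Only the moments of order 0, 1 and 2 occur.\<close>
  define n where "n b = (if b = i then 1 else 0) + (if b = j then 1 else (0::nat))" for b
  let ?f = "\<lambda>b x. normal_density 0 \<sigma> x * x ^ n b"
  have "integrable lborel (?f b)" for b
    using integrable_normal_moment[OF \<sigma>, of 0 "n b"] by simp
  hence "has_bochner_integral lborel (\<lambda>x::'a. \<Prod>b\<in>Basis. ?f b (x \<bullet> b))
      (\<Prod>b\<in>Basis. integral\<^sup>L lborel (?f b))"
    by (rule lborel_integral_prod)
  moreover have "(\<Prod>b\<in>Basis. ?f b (x \<bullet> b)) =
      (\<Prod>b\<in>Basis. normal_density 0 \<sigma> (x \<bullet> b)) * ((x \<bullet> i) * (x \<bullet> j))" for x
  proof -
    have *: "(\<Prod>b\<in>Basis. (x \<bullet> b) ^ (if b = k then 1 else 0)) = x \<bullet> k" if "k \<in> Basis" for k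
    proof -
      have "(\<Prod>b\<in>Basis. (x \<bullet> b) ^ (if b = k then 1 else 0)) = (\<Prod>b\<in>Basis. if b = k then x \<bullet> b else 1)"
        by (rule prod.cong) auto
      thus ?thesis using that by simp
    qed
    have "(\<Prod>b\<in>Basis. (x \<bullet> b) ^ n b) = (x \<bullet> i) * (x \<bullet> j)"
      unfolding n_def power_add prod.distrib using ij by (simp only: *)
    thus ?thesis by (simp add: prod.distrib)
  qed
  moreover have "(\<Prod>b\<in>Basis. integral\<^sup>L lborel (?f b)) = (if i = j then \<sigma>\<^sup>2 else 0)"
  proof -
    have n0: "integral\<^sup>L lborel (\<lambda>x. normal_density 0 \<sigma> x * x ^ 0) = 1"
      using \<sigma> by simp
    have n1: "integral\<^sup>L lborel (\<lambda>x. normal_density 0 \<sigma> x * x ^ 1) = 0"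
      using integral_normal_moment_odd[OF \<sigma>, of 0 0] by simp
    have n2: "integral\<^sup>L lborel (\<lambda>x. normal_density 0 \<sigma> x * x ^ 2) = \<sigma>\<^sup>2"
      using integral_normal_moment_even[OF \<sigma>, of 0 1] by simp
    show ?thesis
    proof (cases "i = j")
      case True
      have "(\<Prod>b\<in>Basis. integral\<^sup>L lborel (?f b)) = (\<Prod>b\<in>Basis. if b = i then \<sigma>\<^sup>2 else 1)"
        using True n0 n2 by (intro prod.cong refl) (simp add: n_def numeral_2_eq_2)
      thus ?thesis using True ij by simp
    next
      case False
      \<comment> \<open>For \<open>i \<noteq> j\<close> the factor at \<open>i\<close> is a first
        moment, which vanishes and kills the product.\<close>
      have "integral\<^sup>L lborel (?f i) = 0"
        using n1 False by (simp add: n_def)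
      hence "(\<Prod>b\<in>Basis. integral\<^sup>L lborel (?f b)) = 0"
        using ij by (intro prod_zero) auto
      thus ?thesis using False by simp
    qed
  qed
  ultimately show ?thesis by simp
qed

text \<open>Expand \<open>x \<bullet> A x\<close> into coordinate products; only the diagonal second
  moments survive, and they add up to the trace.\<close>

lemma isotropic_quadratic_form:
  fixes A :: "'a::euclidean_space \<Rightarrow> 'a"
  assumes \<sigma>: "\<sigma> > 0" and A: "linear A"
  shows "has_bochner_integral lborel
    (\<lambda>x::'a. (\<Prod>b\<in>Basis. normal_density 0 \<sigma> (x \<bullet> b)) * (x \<bullet> A x))
    (\<sigma>\<^sup>2 * (\<Sum>b\<in>Basis. A b \<bullet> b))"
proof -
  let ?g = "\<lambda>x::'a. \<Prod>b\<in>Basis. normal_density 0 \<sigma> (x \<bullet> b)"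
  have "has_bochner_integral lborel
    (\<lambda>x::'a. \<Sum>i\<in>Basis. \<Sum>j\<in>Basis. (A j \<bullet> i) * (?g x * ((x \<bullet> i) * (x \<bullet> j))))
    (\<Sum>i\<in>Basis. \<Sum>j\<in>Basis. (A j \<bullet> i) * (if i = j then \<sigma>\<^sup>2 else 0))"
    by (intro has_bochner_integral_sum has_bochner_integral_mult_right isotropic_second_moment \<sigma>)
  moreover have "(\<Sum>i\<in>Basis. \<Sum>j\<in>Basis. (A j \<bullet> i) * (?g x * ((x \<bullet> i) * (x \<bullet> j)))) = ?g x * (x \<bullet> A x)" for x
  proof -
    have "A x = A (\<Sum>j\<in>Basis. (x \<bullet> j) *\<^sub>R j)" by (simp add: euclidean_representation)
    hence "A x \<bullet> i = (\<Sum>j\<in>Basis. (x \<bullet> j) * (A j \<bullet> i))" for i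
      by (simp add: linear_sum[OF A] linear_cmul[OF A] inner_sum_left)
    hence "x \<bullet> A x = (\<Sum>i\<in>Basis. \<Sum>j\<in>Basis. (x \<bullet> i) * ((x \<bullet> j) * (A j \<bullet> i)))"
      unfolding euclidean_inner[of x "A x"] by (simp add: sum_distrib_left)
    thus ?thesis by (simp add: sum_distrib_left mult_ac)
  qed
  moreover have "(\<Sum>i\<in>Basis. \<Sum>j\<in>Basis. (A j \<bullet> i) * (if i = j then \<sigma>\<^sup>2 else 0)) = \<sigma>\<^sup>2 * (\<Sum>b\<in>Basis. A b \<bullet> b)"
    by (simp add: if_distrib sum_distrib_left mult.commute cong: if_cong)
  ultimately show ?thesis by simp
qed

lemma isotropic_total_mass:
  assumes \<sigma>: "\<sigma> > 0"
  shows "has_bochner_integral lborel (\<lambda>x::'a::euclidean_space. \<Prod>b\<in>Basis. normal_density 0 \<sigma> (x \<bullet> b)) 1"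
  using lborel_integral_prod[of "\<lambda>_::'a. normal_density 0 \<sigma>"] \<sigma> by simp

text \<open>Let \<open>P\<close> carry \<open>Basis\<close> to \<open>E\<close>. Then
  \<open>A \<circ> P\<close> is \<open>P\<close> with its columns scaled by the eigenvalues, and
  multiplicativity lets \<open>op_det P\<close> be cancelled: it is nonzero because
  \<open>P \<circ> Q\<close> is the identity.\<close>

lemma op_det_eigenbasis:
  fixes A :: "'a::euclidean_space \<Rightarrow> 'a"
  assumes E: "orthonormal_basis E" and A: "linear A" and eig: "\<And>e. e \<in> E \<Longrightarrow> A e = l e *\<^sub>R e"
  shows "op_det A = (\<Prod>e\<in>E. l e)"
proof -
  have "card (Basis :: 'a set) = card E" using card_orthonormal_basis[OF E] by simp
  then obtain h where h: "bij_betw h (Basis :: 'a set) E"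
    using finite_same_card_bij[OF finite_Basis finite_orthonormal_basis[OF E]] by blast
  define P where "P x = (\<Sum>b\<in>Basis. (x \<bullet> b) *\<^sub>R h b)" for x :: 'a
  define Q where "Q x = (\<Sum>b\<in>Basis. (x \<bullet> h b) *\<^sub>R b)" for x :: 'a
  have linP: "linear P"
    by (rule linearI)
      (simp_all add: P_def inner_add_left scaleR_left_distrib sum.distrib scaleR_sum_right)
  have P: "P b = h b" if "b \<in> Basis" for b
  proof -
    have "P b = (\<Sum>c\<in>Basis. if c = b then h c else 0)"
      unfolding P_def using that by (intro sum.cong) (auto simp: inner_Basis)
    thus ?thesis using that by simp
  qed
  have "P \<circ> Q = (\<lambda>x. x)"
  proof
    fix x
    have "P (Q x) = (\<Sum>b\<in>Basis. (x \<bullet> h b) *\<^sub>R h b)"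
      unfolding Q_def by (simp add: linear_sum[OF linP] linear_cmul[OF linP] P)
    also have "\<dots> = (\<Sum>e\<in>E. (x \<bullet> e) *\<^sub>R e)"
      by (rule sum.reindex_bij_betw[OF h])
    finally show "(P \<circ> Q) x = x" using orthonormal_basis_expansion[OF E, of x] by simp
  qed
  hence "op_det P * op_det Q = 1"
    using op_det_compose[OF linP, of Q] op_det_id by metis
  hence "op_det P \<noteq> 0" by auto
  moreover have "op_det A * op_det P = (\<Prod>b\<in>Basis. l (h b)) * op_det P"
    using h unfolding op_det_compose[OF A, symmetric]
    by (intro op_det_scaled_columns) (auto simp: P eig bij_betw_def)
  moreover have "(\<Prod>b\<in>Basis. l (h b)) = (\<Prod>e\<in>E. l e)"
    by (rule prod.reindex_bij_betw[OF h])
  ultimately show ?thesis by simp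
qed

text \<open>The log-ratio of the densities is a difference of two quadratic forms plus a constant,
  so its mean needs only two traces and the total mass. The result is the usual Gaussian formula
  with \<Sigma>0 = \<omega> I and \<Sigma>1 = \<open>C\<close>.\<close>

lemma KL_isotropic_gaussian:
  fixes C :: "'a::euclidean_space \<Rightarrow> 'a"
  assumes \<omega>: "\<omega> > 0" and C: "linear (inv C)" and det: "op_det C > 0"
  shows "KL (centred_gaussian (\<lambda>x. \<omega> *\<^sub>R x)) (centred_gaussian C) =
    (\<omega> * (\<Sum>b\<in>Basis. inv C b \<bullet> b) - real DIM('a) + ln (op_det C) - real DIM('a) * ln \<omega>) / 2"
proof -
  let ?k = "DIM('a)" and ?tr = "\<Sum>b\<in>Basis. inv C b \<bullet> b"
  define \<sigma> where "\<sigma> = sqrt \<omega>"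
  have \<sigma>: "\<sigma> > 0" "\<sigma>\<^sup>2 = \<omega>" using \<omega> by (simp_all add: \<sigma>_def)
  define g where "g x = (\<Prod>b\<in>Basis. normal_density 0 \<sigma> (x \<bullet> b))" for x :: 'a
  define f where "f x = exp (- (x \<bullet> inv C x) / 2) / sqrt ((2 * pi) ^ ?k * op_det C)" for x
  \<comment> \<open>Half the logarithm of the ratio of the normalising constants; the powers of
    \<open>2 * pi\<close> cancel.\<close>
  define c where "c = (ln (op_det C) - real ?k * ln \<omega>) / 2"
  have inv\<omega>: "inv (\<lambda>x::'a. \<omega> *\<^sub>R x) = (\<lambda>x. (1 / \<omega>) *\<^sub>R x)"
    using \<omega> by (intro inv_unique_comp) (auto simp: fun_eq_iff)
  have det\<omega>: "op_det (\<lambda>x::'a. \<omega> *\<^sub>R x) = \<omega> ^ ?k"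
    using op_det_scaled_columns[of "\<lambda>x::'a. \<omega> *\<^sub>R x" "\<lambda>_. \<omega>" "\<lambda>x. x"] by (simp add: op_det_id)
  have g_eq: "g x = exp (- (x \<bullet> x) / (2 * \<omega>)) / sqrt ((2 * pi * \<omega>) ^ ?k)" for x
    unfolding g_def normal_density_prod[OF \<sigma>(1)] \<sigma> ..
  have P: "centred_gaussian (\<lambda>x::'a. \<omega> *\<^sub>R x) = density lborel (\<lambda>x. ennreal (g x))"
    unfolding centred_gaussian_def inv\<omega> det\<omega> g_eq by (simp add: power_mult_distrib mult.commute)
  have Q: "centred_gaussian C = density lborel (\<lambda>x. ennreal (f x))"
    unfolding centred_gaussian_def f_def ..
  have f_pos: "f x > 0" for x using det by (simp add: f_def)
  have g_pos: "g x > 0" for x using \<omega> by (simp add: g_eq)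
  have [measurable]: "inv C \<in> borel_measurable borel"
    using C by (intro borel_measurable_continuous_onI linear_continuous_on)
      (simp add: linear_conv_bounded_linear)
  have [measurable]: "f \<in> borel_measurable borel" "g \<in> borel_measurable borel"
    unfolding f_def g_def by measurable
  have log_ratio: "ln (g x / f x) = (x \<bullet> inv C x) / 2 - (x \<bullet> x) / (2 * \<omega>) + c" for x
  proof -
    have "ln (g x) = - (x \<bullet> x) / (2 * \<omega>) - real ?k * (ln (2 * pi) + ln \<omega>) / 2"
      unfolding g_eq using \<omega>
      by (simp add: ln_div ln_sqrt ln_realpow ln_mult_pos)
    moreover have "ln (f x) = - (x \<bullet> inv C x) / 2 - (real ?k * ln (2 * pi) + ln (op_det C)) / 2"
      unfolding f_def using det
      by (simp add: ln_div ln_sqrt ln_realpow ln_mult_pos algebra_simps)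
    moreover have "ln (g x / f x) = ln (g x) - ln (f x)"
      using f_pos[of x] g_pos[of x] by (simp add: ln_div)
    ultimately show ?thesis by (simp add: c_def field_simps)
  qed
  \<comment> \<open>The term \<open>x \<bullet> x\<close> is the quadratic form of the identity,
    whose trace is the dimension.\<close>
  have tr_id: "(\<Sum>b\<in>Basis. id b \<bullet> (b :: 'a)) = real ?k"
    by (simp add: inner_same_Basis)
  have "KL (centred_gaussian (\<lambda>x. \<omega> *\<^sub>R x)) (centred_gaussian C) = (\<integral>x. g x * ln (g x / f x) \<partial>lborel)"
    unfolding KL_def P Q
    by (subst lborel.KL_density_density)
      (use f_pos g_pos in \<open>auto simp: less_imp_le log_def less_imp_neq[symmetric] intro!: AE_I2\<close>)
  also have "\<dots> = \<omega> * ?tr * (1 / 2) - \<omega> * real ?k * (1 / (2 * \<omega>)) + 1 * c"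
  proof (rule has_bochner_integral_integral_eq)
    have "has_bochner_integral lborel
        (\<lambda>x. (g x * (x \<bullet> inv C x)) * (1 / 2) - (g x * (x \<bullet> x)) * (1 / (2 * \<omega>)) + g x * c)
        (\<omega> * ?tr * (1 / 2) - \<omega> * real ?k * (1 / (2 * \<omega>)) + 1 * c)"
      using isotropic_quadratic_form[OF \<sigma>(1) C]
        isotropic_quadratic_form[OF \<sigma>(1) linear_id, where 'a='a, unfolded tr_id]
        isotropic_total_mass[OF \<sigma>(1), where 'a='a] \<sigma>(2)
      by (intro has_bochner_integral_add has_bochner_integral_diff has_bochner_integral_mult_left)
        (simp_all add: g_def)
    thus "has_bochner_integral lborel (\<lambda>x. g x * ln (g x / f x))
        (\<omega> * ?tr * (1 / 2) - \<omega> * real ?k * (1 / (2 * \<omega>)) + 1 * c)"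
      by (simp add: log_ratio algebra_simps)
  qed
  finally show ?thesis using \<omega> by (simp add: c_def field_simps)
qed

subsection \<open>Estimates in terms of the condition number\<close>

lemma orth_projector_UNIV: "orth_projector UNIV x = x"
proof -
  have "UNIV\<^sup>\<bottom> = {0 :: 'a}"
    using vector_eq_rdot[of _ 0] by (auto simp: orthogonal_comp_def orthogonal_def inner_commute)
  thus ?thesis by (auto simp: orth_projector_def)
qed

text \<open>By Parseval, \<open>A\<close> multiplies each coordinate by a factor of modulus at most
  \<open>c\<close>.\<close>

lemma onorm_eigenbasis_le:
  fixes A :: "'a::euclidean_space \<Rightarrow> 'a"
  assumes E: "orthonormal_basis E" and A: "linear A" and eig: "\<And>e. e \<in> E \<Longrightarrow> A e = l e *\<^sub>R e"
    and le: "\<And>e. e \<in> E \<Longrightarrow> \<bar>l e\<bar> \<le> c" and c: "c \<ge> 0"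
  shows "onorm A \<le> c"
proof (rule onorm_le)
  fix x
  have "(norm (A x))\<^sup>2 = (\<Sum>e\<in>E. (l e)\<^sup>2 * (x \<bullet> e)\<^sup>2)"
    unfolding norm_orthonormal_basis_expansion[OF E]
    by (simp add: inner_eigenbasis[OF E A eig] power_mult_distrib)
  also have "\<dots> \<le> (\<Sum>e\<in>E. c\<^sup>2 * (x \<bullet> e)\<^sup>2)"
    using le by (intro sum_mono mult_right_mono abs_le_square_iff[THEN iffD1])
      (simp_all add: abs_of_nonneg[OF c])
  also have "\<dots> = (c * norm x)\<^sup>2"
    by (simp only: power_mult_distrib norm_orthonormal_basis_expansion[OF E] sum_distrib_left)
  finally show "norm (A x) \<le> c * norm x"
    by (rule power2_le_imp_le) (simp add: c)
qed

lemma diff_one_ln_le: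
  fixes t :: real
  assumes t: "0 < t" "t \<le> K" "1 / t \<le> K"
  shows "t - 1 - ln t \<le> (K - 1)\<^sup>2"
proof -
  have "- ln t \<le> 1 / t - 1"
    using ln_le_minus_one[of "1 / t"] t(1) by (simp add: ln_div)
  hence "t - 1 - ln t \<le> t + 1 / t - 2" by simp
  also have "\<dots> \<le> (K - 1)\<^sup>2"
  \<comment> \<open>For \<open>t \<ge> 1\<close> dividing \<open>(t - 1)\<^sup>2\<close> by
    \<open>t\<close> only shrinks it, and \<open>t \<le> K\<close> applies. For \<open>t < 1\<close>
    the same quantity reads \<open>t * (1 / t - 1)\<^sup>2\<close>, and \<open>1 / t \<le> K\<close>
    applies.\<close>
  proof (cases "t \<ge> 1")
    case True
    have "t + 1 / t - 2 = (t - 1)\<^sup>2 / t" using t(1) by (simp add: field_simps power2_eq_square)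
    also have "\<dots> \<le> (t - 1)\<^sup>2" using True by (simp add: divide_le_eq mult_right_le_one_le mult_le_cancel_left1)
    also have "\<dots> \<le> (K - 1)\<^sup>2" using True t by (intro power_mono) auto
    finally show ?thesis .
  next
    case False
    have "t + 1 / t - 2 = t * (1 / t - 1)\<^sup>2" using t(1) by (simp add: field_simps power2_eq_square)
    also have "\<dots> \<le> 1 * (1 / t - 1)\<^sup>2" using False by (intro mult_right_mono) auto
    also have "\<dots> \<le> (K - 1)\<^sup>2" using False t by (simp, intro power_mono) auto
    finally show ?thesis .
  qed
  finally show ?thesis .
qed

lemma abs_diff_one_le:
  fixes t :: real
  assumes t: "0 < t" "t \<le> K" "1 / t \<le> K"
  shows "\<bar>1 / t - 1\<bar> \<le> K - 1"
proof (cases "t \<ge> 1")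
  case True
  \<comment> \<open>Equivalent to \<open>t + 1 / t \<ge> 2\<close>, which is
    \<open>(t - 1)\<^sup>2 \<ge> 0\<close> divided by \<open>t\<close>.\<close>
  have "1 - 1 / t \<le> t - 1"
    using t(1) sum_squares_bound[of 1 t] zero_le_power2[of "t - 1"]
    by (simp add: field_simps power2_eq_square)
  moreover have "1 / t \<le> 1" using True by simp
  ultimately show ?thesis using t by simp
next
  case False
  hence "1 / t \<ge> 1" using t(1) by simp
  thus ?thesis using t by simp
qed

theorem theorem13:
  fixes B :: "'a::euclidean_space \<Rightarrow> 'a"
    and k :: nat and \<nu> :: "nat \<Rightarrow> real" and \<kappa> \<omega> :: real and \<Gamma> :: "'a \<Rightarrow> 'a"
  assumes B: "sym_pos_def B"
    and k: "k = DIM('a)"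
    and \<nu>: "\<nu> = eigenval B"
    and \<kappa>: "\<kappa> = \<nu> 1 / \<nu> k"
    and \<omega>: "\<omega> = (1 / real k) * (\<Sum>i=1..k. inverse (\<nu> i))"
    and \<Gamma>: "\<Gamma> = (\<lambda>x. \<omega> *\<^sub>R orth_projector (range B) x)"
  shows "(\<Gamma> = inv B \<longleftrightarrow> \<kappa> = 1)
    \<and> onorm (\<lambda>x. inv B x - \<Gamma> x) \<le> \<omega> * (\<kappa> - 1)
    \<and> (1 / real k) * KL (centred_gaussian \<Gamma>) (centred_gaussian (inv B)) \<le> (1 / 2) * (\<kappa> - 1)\<^sup>2"
proof -
  have lin: "linear B" and sym: "\<And>x y. B x \<bullet> y = x \<bullet> B y" and pos: "\<And>x. x \<noteq> 0 \<Longrightarrow> 0 < B x \<bullet> x"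
    using B by (auto simp: sym_pos_def_def)
  obtain E l where E: "orthonormal_basis E" and eig: "\<And>e. e \<in> E \<Longrightarrow> B e = l e *\<^sub>R e"
    using spectral_theorem[OF lin sym] by metis
  have finE: "finite E" and cardE: "card E = k" and E_ne: "E \<noteq> {}"
    using finite_orthonormal_basis[OF E] card_orthonormal_basis[OF E]
      orthonormal_basis_nonempty[OF E] k by simp_all
  have kpos: "real k > 0" unfolding k by simp
  have unit: "e \<bullet> e = 1" if "e \<in> E" for e
    using inner_orthonormal_basis[OF E that that] by simp
  have l_pos: "l e > 0" if "e \<in> E" for e
  proof -
    have "e \<noteq> 0" using unit[OF that] by auto
    from pos[OF this] show ?thesis using unit[OF that] by (simp add: eig[OF that])
  qed
  have "inj B"
    using pos by (subst linear_injective_0[OF lin]) fastforce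
  hence bij: "bij B" using lin by (simp add: bij_def linear_injective_imp_surjective)
  \<comment> \<open>Definiteness makes \<open>B\<close> injective, hence surjective, so the
    projector onto its range is the identity.\<close>
  have \<Gamma>_eq: "\<Gamma> = (\<lambda>x. \<omega> *\<^sub>R x)"
    using bij by (simp add: \<Gamma> bij_def orth_projector_UNIV)
  have linI: "linear (inv B)"
    using lin \<open>inj B\<close> by (metis bij bij_is_surj inj_linear_imp_inv_linear)
  have eigI: "inv B e = (1 / l e) *\<^sub>R e" if "e \<in> E" for e
  proof (rule inv_f_eq[OF \<open>inj B\<close>])
    show "B ((1 / l e) *\<^sub>R e) = e"
      using l_pos[OF that] by (simp add: linear_cmul[OF lin] eig[OF that])
  qed
  have \<nu>_eig: "\<nu> ` {1..k} = l ` E"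
    unfolding \<nu> k by (rule eigenval_image[OF E lin eig])
  have ends: "1 \<in> {1..k}" "k \<in> {1..k}" using kpos by auto
  have \<nu>_pos: "\<nu> 1 > 0" "\<nu> k > 0"
    using \<nu>_eig ends l_pos by (metis imageE imageI)+
  have l_le: "l e \<le> \<nu> 1" and l_ge: "\<nu> k \<le> l e" if "e \<in> E" for e
    unfolding \<nu> k using eigenval_bounds[OF E lin eig that] by simp_all
  have \<omega>_eq: "k * \<omega> = (\<Sum>e\<in>E. 1 / l e)"
    using sum_eigenval[OF E lin eig, of inverse] kpos by (simp add: \<omega> \<nu> k inverse_eq_divide)
  \<comment> \<open>As a mean of the \<open>1 / l e\<close>, \<open>\<omega>\<close> lies between
    \<open>1 / \<nu> 1\<close> and \<open>1 / \<nu> k\<close>; this is the upper end.\<close>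
  have \<omega>_le: "\<omega> \<le> 1 / \<nu> k"
  proof -
    have "(\<Sum>e\<in>E. 1 / l e) \<le> (\<Sum>e\<in>E. 1 / \<nu> k)"
      using l_ge \<nu>_pos by (intro sum_mono) (simp add: frac_le)
    hence "k * \<omega> \<le> k * (1 / \<nu> k)" by (simp add: \<omega>_eq cardE)
    thus ?thesis using kpos by (simp only: mult_le_cancel_left_pos)
  qed
  have \<omega>_ge: "1 / \<nu> 1 \<le> \<omega>"
  proof -
    have "(\<Sum>e\<in>E. 1 / \<nu> 1) \<le> (\<Sum>e\<in>E. 1 / l e)"
      using l_le l_pos by (intro sum_mono) (simp add: frac_le)
    hence "k * (1 / \<nu> 1) \<le> k * \<omega>" by (simp add: \<omega>_eq cardE)
    thus ?thesis using kpos by (simp only: mult_le_cancel_left_pos)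
  qed
  have \<omega>_pos: "\<omega> > 0" using \<omega>_ge \<nu>_pos by (meson divide_pos_pos less_le_trans zero_less_one)
  \<comment> \<open>Multiplying the ranges of \<open>\<omega>\<close> and \<open>l e\<close> puts
    \<open>\<omega> * l e\<close> between \<open>\<nu> k / \<nu> 1 = 1 / \<kappa>\<close> and
    \<open>\<nu> 1 / \<nu> k = \<kappa>\<close>.\<close>
  have t: "0 < \<omega> * l e" "\<omega> * l e \<le> \<kappa>" "1 / (\<omega> * l e) \<le> \<kappa>" if "e \<in> E" for e
  proof -
    show "0 < \<omega> * l e" using \<omega>_pos l_pos[OF that] by simp
    have "\<omega> * l e \<le> 1 / \<nu> k * \<nu> 1"
      using \<omega>_le l_le[OF that] \<omega>_pos l_pos[OF that] \<nu>_pos by (intro mult_mono) auto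
    thus "\<omega> * l e \<le> \<kappa>" by (simp add: \<kappa>)
    have "1 / \<nu> 1 * \<nu> k \<le> \<omega> * l e"
      using \<omega>_ge l_ge[OF that] \<omega>_pos \<nu>_pos by (intro mult_mono) auto
    hence "1 / (\<omega> * l e) \<le> 1 / (1 / \<nu> 1 * \<nu> k)"
      using \<nu>_pos by (intro frac_le) auto
    thus "1 / (\<omega> * l e) \<le> \<kappa>" by (simp add: \<kappa>)
  qed
  \<comment> \<open>Any single basis vector bounds \<open>\<kappa> - 1\<close> from below by an
    absolute value.\<close>
  obtain e0 where "e0 \<in> E" using E_ne by blast
  hence "\<bar>1 / (\<omega> * l e0) - 1\<bar> \<le> \<kappa> - 1" by (intro abs_diff_one_le t)
  hence \<kappa>_ge: "\<kappa> \<ge> 1" by linarith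

  define D where "D x = inv B x - \<Gamma> x" for x
  have linD: "linear D"
    unfolding D_def \<Gamma>_eq using linI by (intro linear_compose_sub linear_scale_self)
  have op: "onorm D \<le> \<omega> * (\<kappa> - 1)"
  proof (rule onorm_eigenbasis_le[OF E linD])
    fix e assume e: "e \<in> E"
    show "D e = (1 / l e - \<omega>) *\<^sub>R e"
      by (simp add: D_def \<Gamma>_eq eigI[OF e] scaleR_left_diff_distrib)
    have "1 / l e - \<omega> = \<omega> * (1 / (\<omega> * l e) - 1)"
      using \<omega>_pos by (simp add: field_simps)
    thus "\<bar>1 / l e - \<omega>\<bar> \<le> \<omega> * (\<kappa> - 1)"
      using abs_diff_one_le[OF t[OF e]] \<omega>_pos by (simp add: abs_mult)
  qed (use \<omega>_pos \<kappa>_ge in simp)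

  have iff: "\<Gamma> = inv B \<longleftrightarrow> \<kappa> = 1"
  proof
    assume "\<Gamma> = inv B"
    \<comment> \<open>Applying both operators to \<open>e\<close> forces every eigenvalue to be
      \<open>1 / \<omega>\<close>, in particular the two extreme ones.\<close>
    have "l e = 1 / \<omega>" if "e \<in> E" for e
    proof -
      have "\<omega> *\<^sub>R e = (1 / l e) *\<^sub>R e"
        using eigI[OF that] \<open>\<Gamma> = inv B\<close> \<Gamma>_eq by metis
      moreover have "e \<noteq> 0" using unit[OF that] by auto
      ultimately have "\<omega> = 1 / l e" by simp
      thus ?thesis by simp
    qed
    hence "l ` E \<subseteq> {1 / \<omega>}" by (simp add: image_subset_iff)
    moreover have "\<nu> 1 \<in> l ` E" "\<nu> k \<in> l ` E"
      unfolding \<nu>_eig[symmetric] using ends by simp_all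
    ultimately have "\<nu> 1 = \<nu> k" by (metis singletonD subsetD)
    thus "\<kappa> = 1" using \<nu>_pos by (simp add: \<kappa>)
  next
    assume "\<kappa> = 1"
    hence "onorm D = 0"
      using op onorm_pos_le[of D] linD by (simp add: linear_conv_bounded_linear)
    hence "D x = 0" for x
      using onorm_eq_0[of D] linD by (simp add: linear_conv_bounded_linear)
    thus "\<Gamma> = inv B" by (auto simp: D_def)
  qed

  have det: "op_det (inv B) = (\<Prod>e\<in>E. 1 / l e)"
    by (rule op_det_eigenbasis[OF E linI eigI])
  have det_pos: "op_det (inv B) > 0"
    unfolding det using l_pos by (intro prod_pos) simp
  have ln_det: "ln (op_det (inv B)) = - (\<Sum>e\<in>E. ln (l e))"
    unfolding det using finE l_pos
    by (subst ln_prod) (force simp: ln_div sum_negf[symmetric] intro!: sum.cong)+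
  \<comment> \<open>With covariance \<open>inv B\<close>, the operator in the exponent is
    \<open>B\<close> itself, so the trace in the divergence is the sum of the
    \<open>l e\<close>.\<close>
  have invinv: "inv (inv B) = B" using bij by (rule inv_inv_eq)
  have "(\<Sum>b\<in>Basis. B b \<bullet> b) = (\<Sum>e\<in>E. l e)"
    unfolding trace_orthonormal_basis[OF E lin] using eig unit by (intro sum.cong) auto
  hence "KL (centred_gaussian \<Gamma>) (centred_gaussian (inv B)) =
      (\<omega> * (\<Sum>e\<in>E. l e) - k - (\<Sum>e\<in>E. ln (l e)) - k * ln \<omega>) / 2"
    unfolding \<Gamma>_eq using KL_isotropic_gaussian[OF \<omega>_pos _ det_pos] lin k
    by (simp add: invinv ln_det)
  \<comment> \<open>Since \<open>E\<close> has \<open>k\<close> elements, the terms \<open>k\<close>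
    and \<open>k * ln \<omega>\<close> spread as one copy of \<open>1\<close> and of
    \<open>ln \<omega>\<close> per eigenvector.\<close>
  also have "\<dots> = (\<Sum>e\<in>E. \<omega> * l e - 1 - ln (\<omega> * l e)) / 2"
  proof -
    have "(\<Sum>e\<in>E. \<omega> * l e - 1 - ln (\<omega> * l e)) = (\<Sum>e\<in>E. \<omega> * l e - 1 - (ln \<omega> + ln (l e)))"
      using \<omega>_pos l_pos by (intro sum.cong) (auto simp: ln_mult_pos)
    thus ?thesis by (simp add: sum_subtractf sum.distrib sum_distrib_left cardE)
  qed
  also have "\<dots> \<le> (\<Sum>e\<in>E. (\<kappa> - 1)\<^sup>2) / 2"
    using t by (intro divide_right_mono sum_mono diff_one_ln_le) auto
  also have "\<dots> = k * ((1 / 2) * (\<kappa> - 1)\<^sup>2)" by (simp add: cardE)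
  finally have "(1 / real k) * KL (centred_gaussian \<Gamma>) (centred_gaussian (inv B)) \<le> (1 / 2) * (\<kappa> - 1)\<^sup>2"
    using kpos by (simp add: pos_divide_le_eq mult.commute)
  with iff op show ?thesis by (simp add: D_def[abs_def])
qed

end
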